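(* For every $n,a,b\geq 0$, the number of partitions $\lambda$ of $n$ satisfying $r(\lambda)=a$ and $s(\lambda)=b$ equals the number of partitions of $n$ with exactly $a$ even parts and exactly $b$ odd parts (parts counted with multiplicity).
   Context: For an integer partition $\lambda$, pair equal parts of $\lambda$ as far as possible: for each part size occurring with odd multiplicity exactly one copy remains unpaired, and a part size of even multiplicity is completely paired. Let $r(\lambda)$ be the largest part size that participates in at least one pair (i.e. the largest part size of multiplicity at least $2$), with $r(\lambda)=0$ if $\lambda$ has distinct parts. Write the unpaired parts (the part sizes of odd multiplicity, each once) in decreasing order $u_1>u_2>\cdots>u_s$ and let $s(\lambda)=u_1-u_2+u_3-u_4+\cdots$ (so $s(\lambda)=0$ if there are no unpaired parts). *)

theory Defs
  imports Main "HOL-Library.Multiset"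
begin

definition partitions :: "nat \<Rightarrow> nat multiset set" where
  "partitions n = {p. 0 \<notin># p \<and> sum_mset p = n}"

definition r_stat :: "nat multiset \<Rightarrow> nat" where
  "r_stat p = (if {k. count p k \<ge> 2} = {} then 0 else Max {k. count p k \<ge> 2})"

definition unpaired_parts :: "nat multiset \<Rightarrow> nat list" where
  "unpaired_parts p = rev (sorted_list_of_set {k. odd (count p k)})"

(* Indices start at 0, so u_1 gets the sign +.  The sum is taken in int to avoid
   truncated subtraction. *)
definition s_stat :: "nat multiset \<Rightarrow> int" where
  "s_stat p = (\<Sum>i<length (unpaired_parts p). (-1) ^ i * int (unpaired_parts p ! i))"

end

theory Submission
  imports Defs
begin

text \<open>
  Pairing writes a partition as two copies of a partition \<open>q\<close> together with a partition \<open>d\<close> into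
  distinct parts; here \<open>r\<close> is the largest part of \<open>q\<close>, and \<open>s\<close> is the alternating sum of \<open>d\<close>, which
  is also the alternating sum of the whole partition. Splitting by parity writes a partition as
  the double of a partition \<open>q\<close> together with a partition into odd parts. Conjugation exchanges the
  largest part with the number of parts, and the alternating sum with the number of odd parts;
  instead of conjugating, we observe that both pairs of statistics obey the same recurrence.
  Comparing the two decompositions of all partitions and cancelling the common factor (the
  generating function of \<open>q\<close>, with constant term \<open>1\<close>) shows that partitions into distinct parts with
  alternating sum \<open>b\<close> and partitions into \<open>b\<close> odd parts are equinumerous, and the theorem follows
  by using the decompositions again, now keeping track of \<open>a\<close>.
\<close>

section \<open>Largest part and finiteness of the set of partitions\<close>

text \<open>Inserting \<open>0\<close> gives the empty partition the value \<open>0\<close>, in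
  agreement with the default value of \<open>r_stat\<close>.\<close>

definition largest_part :: "nat multiset \<Rightarrow> nat" where
  "largest_part p = Max (insert 0 (set_mset p))"

lemma largest_part_le_iff: "largest_part p \<le> N \<longleftrightarrow> (\<forall>x\<in>#p. x \<le> N)"
  by (simp add: largest_part_def)

lemma le_largest_part: "x \<in># p \<Longrightarrow> x \<le> largest_part p"
  by (simp add: largest_part_def)

lemma largest_part_in: "largest_part p \<noteq> 0 \<Longrightarrow> largest_part p \<in># p"
  using Max_in[of "insert 0 (set_mset p)"] by (auto simp: largest_part_def)

lemma largest_part_add_mset: "largest_part q \<le> N \<Longrightarrow> largest_part (add_mset N q) = N"
  by (intro antisym le_largest_part) (auto simp: largest_part_le_iff)

lemma partitions_0: "partitions 0 = {{#}}"
  by (auto simp: partitions_def) (metis multiset_nonemptyE)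

lemma partitions_part_le: "p \<in> partitions n \<Longrightarrow> x \<in># p \<Longrightarrow> x \<le> n"
  by (auto simp: partitions_def dest!: multi_member_split)

lemma partitions_largest_part_le: "p \<in> partitions n \<Longrightarrow> largest_part p \<le> n"
  using partitions_part_le by (auto simp: largest_part_le_iff)

lemma size_le_sum_mset: "0 \<notin># p \<Longrightarrow> size p \<le> sum_mset p" for p :: "nat multiset"
  by (induction p) auto

lemma partitions_size_le: "p \<in> partitions n \<Longrightarrow> size p \<le> n"
  using size_le_sum_mset by (auto simp: partitions_def)

lemma finite_partitions [simp]: "finite (partitions n)"
proof (induction n rule: less_induct)
  case (less n)
  have "partitions n \<subseteq> insert {#} (\<Union>k\<in>{1..n}. add_mset k ` partitions (n - k))"
  proof
    fix p assume p: "p \<in> partitions n"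
    show "p \<in> insert {#} (\<Union>k\<in>{1..n}. add_mset k ` partitions (n - k))"
    proof (cases p)
      case (add k q)
      then have "k \<in> {1..n}" "q \<in> partitions (n - k)"
        using p by (auto simp: partitions_def)
      then show ?thesis using add by blast
    qed simp
  qed
  moreover have "finite (\<Union>k\<in>{1..n}. add_mset k ` partitions (n - k))"
    using less by auto
  ultimately show ?case by (meson finite_insert finite_subset)
qed

lemma card_fibres:
  assumes "finite A" "finite J" "\<And>x. x \<in> A \<Longrightarrow> f x \<in> J"
  shows "card {x \<in> A. Q x} = (\<Sum>j\<in>J. card {x \<in> A. f x = j \<and> Q x})"
proof -
  have "{x \<in> A. Q x} = (\<Union>j\<in>J. {x \<in> A. f x = j \<and> Q x})"
    using assms(3) by auto
  then show ?thesis
    by (simp only:) (rule card_UN_disjoint, use assms in auto)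
qed

section \<open>Alternating sum, and the recurrence from removing the largest part\<close>

lemma s_stat_cong:
  "{k. odd (count p k)} = {k. odd (count q k)} \<Longrightarrow> s_stat p = s_stat q"
  by (simp add: s_stat_def unpaired_parts_def)

lemma s_stat_add_twice: "s_stat (q + q + d) = s_stat d"
  by (rule s_stat_cong) simp

lemma finite_odd_count: "finite {k. odd (count p k)}"
  by (rule finite_subset[of _ "set_mset p"]) (auto dest: odd_pos)

text \<open>Even multiplicity means that \<open>N\<close> is not yet unpaired, so it becomes the new
  first unpaired part; all others move one index on and change sign.\<close>

lemma s_stat_add_fresh_greatest:
  assumes "\<And>x. x \<in># p \<Longrightarrow> x \<le> N" "even (count p N)"
  shows "s_stat (add_mset N p) = int N - s_stat p"
proof -
  let ?U = "{k. odd (count p k)}"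
  have less: "x < N" if "x \<in> ?U" for x
    using that assms by (metis count_eq_zero_iff even_zero le_neq_implies_less mem_Collect_eq)
  have eq: "{k. odd (count (add_mset N p) k)} = insert N ?U"
    using assms(2) by auto
  have "sorted_list_of_set (insert N ?U) = sorted_list_of_set ?U @ [N]"
    using less finite_odd_count[of p]
    by (intro sorted_distinct_set_unique)
      (auto simp: sorted_append simp del: sorted_list_of_set_insert_remove intro: less_imp_le)
  then have "unpaired_parts (add_mset N p) = N # unpaired_parts p"
    unfolding unpaired_parts_def eq by simp
  then show ?thesis
    by (simp add: s_stat_def sum.lessThan_Suc_shift sum_negf del: sum.lessThan_Suc)
qed

text \<open>If \<open>N\<close> is already unpaired, the fresh case applies to
  \<open>add_mset N p\<close> instead, and two added copies of \<open>N\<close> leave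
  \<open>s_stat\<close> unchanged; the resulting equation is symmetric in the two alternating
  sums.\<close>

lemma s_stat_add_greatest:
  assumes "largest_part p \<le> N"
  shows "s_stat (add_mset N p) = int N - s_stat p"
proof (cases "even (count p N)")
  case True
  then show ?thesis
    using assms by (intro s_stat_add_fresh_greatest) (auto simp: largest_part_le_iff)
next
  case False
  have "s_stat (add_mset N (add_mset N p)) = int N - s_stat (add_mset N p)"
    using assms False by (intro s_stat_add_fresh_greatest) (auto simp: largest_part_le_iff)
  moreover have "s_stat (add_mset N (add_mset N p)) = s_stat p"
    by (rule s_stat_cong) auto
  ultimately show ?thesis by simp
qed

text \<open>One copy of the largest part is removed; what remains is any partition of
  \<open>n - N\<close> whose largest part \<open>j\<close> is at most \<open>N\<close>.\<close>

lemma card_largest_s_stat_rec: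
  assumes "0 < N" "N \<le> n"
  shows "card {p \<in> partitions n. largest_part p = N \<and> s_stat p = b} =
    (\<Sum>j\<le>N. card {p \<in> partitions (n - N). largest_part p = j \<and> s_stat p = int N - b})"
proof -
  let ?A = "{q \<in> partitions (n - N). largest_part q \<le> N}"
  have "bij_betw (add_mset N) {q \<in> ?A. s_stat q = int N - b}
          {p \<in> partitions n. largest_part p = N \<and> s_stat p = b}"
  proof (rule bij_betw_imageI)
    show "add_mset N ` {q \<in> ?A. s_stat q = int N - b} =
      {p \<in> partitions n. largest_part p = N \<and> s_stat p = b}" (is "?L = ?R")
    proof (intro equalityI subsetI)
      fix p assume "p \<in> ?L"
      then show "p \<in> ?R"
        using assms by (auto simp: partitions_def largest_part_add_mset s_stat_add_greatest)
    next
      fix p assume p: "p \<in> ?R"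
      then obtain q where q: "p = add_mset N q"
        using largest_part_in[of p] assms(1) by (auto dest: multi_member_split)
      have "largest_part q \<le> N"
        using p q le_largest_part[of _ p] by (auto simp: largest_part_le_iff)
      then show "p \<in> ?L"
        using p q s_stat_add_greatest[of q N] by (auto simp: partitions_def)
    qed
  qed (simp add: inj_on_def)
  then have "card {p \<in> partitions n. largest_part p = N \<and> s_stat p = b} =
      card {q \<in> ?A. s_stat q = int N - b}"
    by (simp add: bij_betw_same_card)
  also have "\<dots> = (\<Sum>j\<le>N. card {q \<in> ?A. largest_part q = j \<and> s_stat q = int N - b})"
    by (rule card_fibres) auto
  also have "\<dots> = (\<Sum>j\<le>N. card {p \<in> partitions (n - N). largest_part p = j \<and> s_stat p = int N - b})"
    by (intro sum.cong refl arg_cong[of _ _ card]) auto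
  finally show ?thesis .
qed

section \<open>Numbers of parts and of odd parts, and the recurrence from removing the first
  column\<close>

lemma sum_mset_image_Suc: "sum_mset (image_mset Suc q) = sum_mset q + size q"
  by (induction q) auto

text \<open>Exactly one of \<open>x\<close> and \<open>Suc x\<close> is odd, so each part is counted
  once.\<close>

lemma size_odd_image_Suc: "size (filter_mset odd (image_mset Suc q)) + size (filter_mset odd q) = size q"
  by (induction q) auto

lemma image_pred_Suc: "image_mset (\<lambda>x. x - 1) (image_mset Suc q) = q"
  by (simp add: multiset.map_comp comp_def)

lemma filter_nonzero: "0 \<notin># q \<Longrightarrow> filter_mset (\<lambda>x. x \<noteq> 0) q = q" for q :: "nat multiset"
  by (auto simp: filter_mset_eq_conv intro: gr0I)

text \<open>Lowering every part by \<open>1\<close> loses exactly the parts equal to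
  \<open>1\<close>; the drop in size tells how many must be put back.\<close>

lemma image_Suc_filter_nonzero_pred:
  assumes "0 \<notin># p"
  shows "image_mset Suc (filter_mset (\<lambda>x. x \<noteq> 0) (image_mset (\<lambda>x. x - 1) p)) +
    replicate_mset (size p - size (filter_mset (\<lambda>x. x \<noteq> 0) (image_mset (\<lambda>x. x - 1) p))) 1 = p"
  using assms
proof (induction p)
  case (add x p)
  have "size (filter_mset (\<lambda>x. x \<noteq> 0) (image_mset (\<lambda>x. x - 1) p)) \<le> size p"
    by (metis size_filter_mset_lesseq size_image_mset)
  then show ?case
    using add by (cases "x = 1") (auto simp: Suc_diff_le)
qed simp

text \<open>This is the conjugate of removing the largest part: each of the \<open>N\<close> parts
  is lowered by \<open>1\<close>, which flips its parity, and zeros are dropped. As zeros are even,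
  the odd parts before and after add up to \<open>N\<close>.\<close>

lemma card_size_odd_rec:
  assumes "0 < N" "N \<le> n"
  shows "card {p \<in> partitions n. size p = N \<and> int (size (filter_mset odd p)) = b} =
    (\<Sum>j\<le>N. card {p \<in> partitions (n - N). size p = j \<and> int (size (filter_mset odd p)) = int N - b})"
proof -
  let ?A = "{q \<in> partitions (n - N). size q \<le> N}"
  \<comment> \<open>In effect \<open>?f\<close> pads \<open>q\<close> with zeros to \<open>N\<close>
    parts and then raises each by \<open>1\<close>; \<open>?g\<close> undoes this.\<close>
  let ?f = "\<lambda>q. image_mset Suc q + replicate_mset (N - size q) 1"
  let ?g = "\<lambda>p. filter_mset (\<lambda>x. x \<noteq> 0) (image_mset (\<lambda>x. x - 1) p)"
  let ?L = "{q \<in> ?A. int (size (filter_mset odd q)) = int N - b}"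
  let ?R = "{p \<in> partitions n. size p = N \<and> int (size (filter_mset odd p)) = b}"
  have filter_rep: "filter_mset odd (replicate_mset k (Suc 0)) = replicate_mset k (Suc 0)" for k
    by (induction k) auto
  have f_in: "?f q \<in> partitions n \<longleftrightarrow> q \<in> partitions (n - N)"
    if "0 \<notin># q" "size q \<le> N" for q
    using that assms by (auto simp: partitions_def sum_mset_image_Suc)
  have f_odd: "size (filter_mset odd (?f q)) + size (filter_mset odd q) = N"
    if "size q \<le> N" for q
    using that size_odd_image_Suc[of q] by (simp add: filter_rep)
  have gf: "?g (?f q) = q" if "0 \<notin># q" for q
  proof -
    have "?g (replicate_mset (N - size q) (1::nat)) = {#}"
      by (auto simp: filter_mset_eq_conv image_replicate_mset)
    moreover have "?g (image_mset Suc q) = q"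
      unfolding image_pred_Suc using that by (rule filter_nonzero)
    ultimately show ?thesis
      unfolding image_mset_union filter_union_mset by (simp only: add_0_right)
  qed
  have fg: "?f (?g p) = p" if "0 \<notin># p" "size p = N" for p
    using image_Suc_filter_nonzero_pred[OF that(1)] that(2) by simp
  have g_le: "size (?g p) \<le> size p" for p
    by (metis size_filter_mset_lesseq size_image_mset)
  have "bij_betw ?f ?L ?R"
  proof (rule bij_betw_byWitness[of _ ?g])
    show "\<forall>q\<in>?L. ?g (?f q) = q"
    proof
      fix q assume "q \<in> ?L"
      then have "0 \<notin># q" by (simp add: partitions_def)
      then show "?g (?f q) = q" by (rule gf)
    qed
    show "\<forall>p\<in>?R. ?f (?g p) = p"
    proof
      fix p assume "p \<in> ?R"
      then have "0 \<notin># p" "size p = N" by (auto simp: partitions_def)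
      then show "?f (?g p) = p" by (rule fg)
    qed
    show "?f ` ?L \<subseteq> ?R"
    proof (rule image_subsetI)
      fix q assume q: "q \<in> ?L"
      then have *: "0 \<notin># q" "size q \<le> N" by (auto simp: partitions_def)
      show "?f q \<in> ?R"
        using q f_in[OF *] f_odd[OF *(2)] by auto
    qed
    show "?g ` ?R \<subseteq> ?L"
    proof (rule image_subsetI)
      fix p assume p: "p \<in> ?R"
      then have *: "0 \<notin># p" "size p = N" by (auto simp: partitions_def)
      have **: "0 \<notin># ?g p" "size (?g p) \<le> N" using g_le[of p] * by auto
      show "?g p \<in> ?L"
        using p ** f_in[OF **] f_odd[OF **(2)] unfolding fg[OF *] by auto
    qed
  qed
  then have "card ?R = card ?L"
    by (simp add: bij_betw_same_card)
  also have "\<dots> = (\<Sum>j\<le>N. card {q \<in> ?A. size q = j \<and> int (size (filter_mset odd q)) = int N - b})"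
    by (rule card_fibres) auto
  also have "\<dots> = (\<Sum>j\<le>N. card {p \<in> partitions (n - N). size p = j \<and> int (size (filter_mset odd p)) = int N - b})"
    by (intro sum.cong refl arg_cong[of _ _ card]) auto
  finally show ?thesis .
qed

section \<open>Equidistribution of the two pairs of statistics\<close>

lemma largest_part_eq_0_iff: "p \<in> partitions n \<Longrightarrow> largest_part p = 0 \<longleftrightarrow> p = {#}"
  using largest_part_le_iff[of p 0]
  by (auto simp: partitions_def) (metis multiset_nonemptyE)

text \<open>Both counts satisfy the same recurrence, which leads from \<open>n\<close> to
  \<open>n - N\<close> and from \<open>b\<close> to \<open>int N - b\<close>; hence \<open>N\<close>
  and the integer \<open>b\<close> stay arbitrary in the induction. For \<open>N = 0\<close> only
  the empty partition can qualify, and for \<open>n < N\<close> nothing does.\<close>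

lemma card_largest_s_stat_eq_card_size_odd:
  "card {p \<in> partitions n. largest_part p = N \<and> s_stat p = b} =
   card {p \<in> partitions n. size p = N \<and> int (size (filter_mset odd p)) = b}"
proof (induction n arbitrary: N b rule: less_induct)
  case (less n)
  consider "N = 0" | "n < N" | "0 < N" "N \<le> n" by linarith
  then show ?case
  proof cases
    case 1
    have "{p \<in> partitions n. largest_part p = N \<and> s_stat p = b} =
        {p \<in> partitions n. size p = N \<and> int (size (filter_mset odd p)) = b}"
      using largest_part_eq_0_iff by (auto simp: 1 s_stat_def unpaired_parts_def)
    then show ?thesis by simp
  next
    case 2
    then have "{p \<in> partitions n. largest_part p = N \<and> s_stat p = b} = {}"
      "{p \<in> partitions n. size p = N \<and> int (size (filter_mset odd p)) = b} = {}"
      using partitions_largest_part_le partitions_size_le by (auto simp flip: not_le)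
    then show ?thesis by (simp only:)
  next
    case 3
    then show ?thesis
      unfolding card_largest_s_stat_rec[OF 3] card_size_odd_rec[OF 3]
      by (intro sum.cong refl less) auto
  qed
qed

lemma card_largest_eq_card_size:
  "card {p \<in> partitions n. largest_part p = a} = card {p \<in> partitions n. size p = a}"
proof -
  let ?odd = "\<lambda>p. int (size (filter_mset odd p))"
  \<comment> \<open>A finite index set containing all values of both statistics, so that both fibre
    sums have the same range.\<close>
  let ?J = "s_stat ` partitions n \<union> ?odd ` partitions n"
  have "card {p \<in> partitions n. largest_part p = a} =
      (\<Sum>b\<in>?J. card {p \<in> partitions n. s_stat p = b \<and> largest_part p = a})"
    by (rule card_fibres) auto
  also have "\<dots> = (\<Sum>b\<in>?J. card {p \<in> partitions n. ?odd p = b \<and> size p = a})"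
    using card_largest_s_stat_eq_card_size_odd by (simp add: conj_commute)
  also have "\<dots> = card {p \<in> partitions n. size p = a}"
    by (rule card_fibres[symmetric]) auto
  finally show ?thesis .
qed

lemma card_s_stat_eq_card_odd:
  "card {p \<in> partitions n. s_stat p = int b} = card {p \<in> partitions n. size (filter_mset odd p) = b}"
proof -
  have "card {p \<in> partitions n. s_stat p = int b} =
      (\<Sum>N\<le>n. card {p \<in> partitions n. largest_part p = N \<and> s_stat p = int b})"
    by (rule card_fibres) (auto simp: partitions_largest_part_le)
  also have "\<dots> = (\<Sum>N\<le>n. card {p \<in> partitions n. size p = N \<and> size (filter_mset odd p) = b})"
    by (simp add: card_largest_s_stat_eq_card_size_odd)
  also have "\<dots> = card {p \<in> partitions n. size (filter_mset odd p) = b}"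
    by (rule card_fibres[symmetric]) (auto simp: partitions_size_le)
  finally show ?thesis .
qed

section \<open>Decompositions by pairing and by parity\<close>

lemma card_convolution:
  fixes n :: nat
  assumes "bij_betw f (SIGMA k:{k. 2 * k \<le> n}. A k \<times> B (n - 2 * k)) C"
    and "\<And>k. finite (A k)" "\<And>k. finite (B k)"
  shows "card C = (\<Sum>k | 2 * k \<le> n. card (A k) * card (B (n - 2 * k)))"
proof -
  have "finite {k. 2 * k \<le> n}"
    by (rule finite_subset[of _ "{..n}"]) auto
  then show ?thesis
    using bij_betw_same_card[OF assms(1)] assms(2,3)
    by (simp add: card_cartesian_product)
qed

text \<open>A new part \<open>x\<close> either meets a copy in \<open>d\<close>, and the pair moves
  to \<open>q\<close>, or joins \<open>d\<close> as unpaired.\<close>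

lemma mset_pairing_exists: "\<exists>q d. p = q + q + d \<and> (\<forall>x. count d x \<le> 1)"
proof (induction p)
  case (add x p)
  then obtain q d where p: "p = q + q + d" and d: "\<forall>x. count d x \<le> 1" by blast
  show ?case
  proof (cases "x \<in># d")
    case True
    then obtain d' where d': "d = add_mset x d'" by (auto dest: multi_member_split)
    have "add_mset x p = add_mset x q + add_mset x q + d'"
      by (simp add: p d')
    moreover have "count d' y \<le> 1" for y
      using d[rule_format, of y] by (auto simp: d' split: if_splits)
    ultimately show ?thesis by blast
  next
    case False
    have "add_mset x p = q + q + add_mset x d"
      by (simp add: p)
    moreover have "\<forall>y. count (add_mset x d) y \<le> 1"
      using d False by (simp add: not_in_iff)
    ultimately show ?thesis by blast
  qed
qed auto

text \<open>The multiplicities in \<open>q\<close> and \<open>d\<close> are the quotient and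
  remainder on dividing the total multiplicity by \<open>2\<close>.\<close>

lemma mset_pairing_unique:
  assumes "q + q + d = q' + q' + d'" "\<And>x. count d x \<le> 1" "\<And>x. count d' x \<le> 1"
  shows "q = q' \<and> d = d'"
proof -
  have "count q x = count q' x \<and> count d x = count d' x" for x
  proof -
    have "2 * count q x + count d x = 2 * count q' x + count d' x"
      using arg_cong[OF assms(1), of "\<lambda>m. count m x"] by simp
    then show ?thesis using assms(2,3)[of x] by presburger
  qed
  then show ?thesis by (simp add: multiset_eq_iff)
qed

lemma r_stat_pairing:
  assumes "0 \<notin># q" "\<And>x. count d x \<le> 1"
  shows "r_stat (q + q + d) = largest_part q"
proof -
  have *: "2 \<le> count (q + q + d) k \<longleftrightarrow> k \<in># q" for k
    using assms(2)[of k] by (cases "k \<in># q") (auto simp: not_in_iff count_greater_zero_iff[symmetric] simp del: count_greater_zero_iff)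
  show ?thesis
    unfolding r_stat_def * by (auto simp: largest_part_def)
qed

text \<open>The predicate \<open>P\<close> allows two uses: with \<open>r_stat\<close> unrestricted
  for the cancellation, and with \<open>r_stat\<close> prescribed for the final count.\<close>

lemma card_r_stat_s_stat:
  "card {p \<in> partitions n. P (r_stat p) \<and> s_stat p = b} =
    (\<Sum>k | 2 * k \<le> n. card {q \<in> partitions k. P (largest_part q)} *
      card {d \<in> partitions (n - 2 * k). (\<forall>x. count d x \<le> 1) \<and> s_stat d = b})"
proof (rule card_convolution)
  let ?S = "SIGMA k:{k. 2 * k \<le> n}. {q \<in> partitions k. P (largest_part q)} \<times>
      {d \<in> partitions (n - 2 * k). (\<forall>x. count d x \<le> 1) \<and> s_stat d = b}"
  let ?f = "\<lambda>(k, q, d). q + q + d :: nat multiset"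
  show "bij_betw ?f ?S {p \<in> partitions n. P (r_stat p) \<and> s_stat p = b}"
  proof (rule bij_betw_imageI)
    show "inj_on ?f ?S"
      by (rule inj_onI) (auto simp: partitions_def dest: mset_pairing_unique)
    show "?f ` ?S = {p \<in> partitions n. P (r_stat p) \<and> s_stat p = b}" (is "_ = ?R")
    proof (intro equalityI subsetI)
      fix p assume "p \<in> ?f ` ?S"
      then obtain k q d where *: "p = q + q + d" "2 * k \<le> n" "q \<in> partitions k"
        "P (largest_part q)" "d \<in> partitions (n - 2 * k)" "\<And>x. count d x \<le> 1" "s_stat d = b"
        by auto
      have "r_stat p = largest_part q"
        unfolding *(1) using * by (intro r_stat_pairing) (auto simp: partitions_def)
      moreover have "s_stat p = b"
        using * by (simp add: s_stat_add_twice)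
      ultimately show "p \<in> ?R"
        using * by (auto simp: partitions_def)
    next
      fix p assume p: "p \<in> ?R"
      obtain q d where *: "p = q + q + d" "\<And>x. count d x \<le> 1"
        using mset_pairing_exists[of p] by blast
      have "r_stat p = largest_part q"
        unfolding *(1) using * p by (intro r_stat_pairing) (auto simp: partitions_def)
      moreover have "s_stat d = b"
        using p * by (simp add: s_stat_add_twice)
      ultimately have "(sum_mset q, q, d) \<in> ?S"
        using p * by (auto simp: partitions_def)
      then show "p \<in> ?f ` ?S"
        using *(1) by force
    qed
  qed
qed auto

lemma sum_mset_double: "sum_mset (image_mset ((*) 2) q) = 2 * sum_mset q" for q :: "nat multiset"
  by (induction q) auto

lemma filter_even_double_add:
  fixes q :: "nat multiset"
  assumes "\<And>x. x \<in># d \<Longrightarrow> odd x"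
  shows "filter_mset even (image_mset ((*) 2) q + d) = image_mset ((*) 2) q"
    and "filter_mset odd (image_mset ((*) 2) q + d) = d"
proof -
  have "filter_mset even (image_mset ((*) 2) q) = image_mset ((*) 2) q"
    "filter_mset odd (image_mset ((*) 2) q) = {#}"
    by (induction q) auto
  moreover have "filter_mset even d = {#}" "filter_mset odd d = d"
    using assms by (induction d) auto
  ultimately show "filter_mset even (image_mset ((*) 2) q + d) = image_mset ((*) 2) q"
    "filter_mset odd (image_mset ((*) 2) q + d) = d"
    by simp_all
qed

text \<open>The parity counterpart: halving the even parts gives \<open>q\<close>, and the odd parts
  form \<open>d\<close>. The sum has the same shape as for pairing, so the factors can be
  compared.\<close>

lemma card_even_odd:
  "card {p \<in> partitions n. P (size (filter_mset even p)) \<and> size (filter_mset odd p) = b} =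
    (\<Sum>k | 2 * k \<le> n. card {q \<in> partitions k. P (size q)} *
      card {d \<in> partitions (n - 2 * k). (\<forall>x\<in>#d. odd x) \<and> size d = b})"
proof (rule card_convolution)
  let ?S = "SIGMA k:{k. 2 * k \<le> n}. {q \<in> partitions k. P (size q)} \<times>
      {d \<in> partitions (n - 2 * k). (\<forall>x\<in>#d. odd x) \<and> size d = b}"
  let ?f = "\<lambda>(k, q, d). image_mset ((*) 2) q + d :: nat multiset"
  show "bij_betw ?f ?S
    {p \<in> partitions n. P (size (filter_mset even p)) \<and> size (filter_mset odd p) = b}"
  proof (rule bij_betw_imageI)
    have inj: "q = q' \<and> d = d'"
      if eq: "image_mset ((*) 2) q + d = image_mset ((*) 2) q' + d'"
        and "\<forall>x\<in>#d. odd x" "\<forall>x\<in>#d'. odd x" for q q' d d' :: "nat multiset"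
    proof -
      have "image_mset ((*) 2) q = image_mset ((*) 2) q'" "d = d'"
        using arg_cong[OF eq, of "filter_mset even"] arg_cong[OF eq, of "filter_mset odd"] that(2,3)
        using filter_even_double_add[of d q] filter_even_double_add[of d' q'] by auto
      moreover have "inj (image_mset ((*) (2::nat)))"
        by (rule multiset.inj_map) (auto simp: inj_def)
      ultimately show ?thesis by (auto dest: injD)
    qed
    show "inj_on ?f ?S"
      by (rule inj_onI) (auto simp: partitions_def dest!: inj)
    show "?f ` ?S = {p \<in> partitions n. P (size (filter_mset even p)) \<and> size (filter_mset odd p) = b}"
      (is "_ = ?R")
    proof (intro equalityI subsetI)
      fix p assume "p \<in> ?f ` ?S"
      then obtain k q d where *: "p = image_mset ((*) 2) q + d" "2 * k \<le> n" "q \<in> partitions k"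
        "P (size q)" "d \<in> partitions (n - 2 * k)" "\<forall>x\<in>#d. odd x" "size d = b"
        by auto
      have "filter_mset even p = image_mset ((*) 2) q" "filter_mset odd p = d"
        unfolding *(1) using *(6) filter_even_double_add[of d q] by auto
      then have "size (filter_mset even p) = size q" "size (filter_mset odd p) = b"
        using *(7) by simp_all
      moreover have "p \<in> partitions n"
        using *(2,3,5) unfolding *(1) by (auto simp: partitions_def sum_mset_double)
      ultimately show "p \<in> ?R"
        using *(4) by simp
    next
      fix p assume p: "p \<in> ?R"
      define q where "q = image_mset (\<lambda>x. x div 2) (filter_mset even p)"
      have q: "image_mset ((*) 2) q = filter_mset even p"
        unfolding q_def multiset.map_comp comp_def
        by (rule trans[OF image_mset_cong[of _ _ "\<lambda>x. x"]]) auto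
      then have eq: "p = image_mset ((*) 2) q + filter_mset odd p"
        using multiset_partition[of p even] by simp
      have "n = 2 * sum_mset q + sum_mset (filter_mset odd p)"
        using arg_cong[OF eq, of sum_mset] p by (simp add: partitions_def sum_mset_double)
      moreover have "size q = size (filter_mset even p)"
        by (simp add: q_def)
      moreover have "0 \<notin># q"
        using p by (auto simp: q_def partitions_def elim!: evenE)
      ultimately have "(sum_mset q, q, filter_mset odd p) \<in> ?S"
        using p by (auto simp: partitions_def)
      then show "p \<in> ?f ` ?S"
        by (rule rev_image_eqI) (simp only: prod.case eq[symmetric])
    qed
  qed
qed auto

section \<open>Cancellation of the common factor and the final count\<close>

text \<open>The term \<open>k = 0\<close> isolates \<open>D n\<close> and \<open>E n\<close>, since
  \<open>P 0 = 1\<close>; all other terms involve smaller arguments and agree by induction.\<close>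

lemma convolution_cancel:
  fixes P D E :: "nat \<Rightarrow> nat"
  assumes "\<And>n. (\<Sum>k | 2 * k \<le> n. P k * D (n - 2 * k)) = (\<Sum>k | 2 * k \<le> n. P k * E (n - 2 * k))"
    and "P 0 = 1"
  shows "D n = E n"
proof (induction n rule: less_induct)
  case (less n)
  have fin: "finite {k. 2 * k \<le> n}"
    by (rule finite_subset[of _ "{..n}"]) auto
  have "(\<Sum>k\<in>{k. 2 * k \<le> n} - {0}. P k * D (n - 2 * k)) =
      (\<Sum>k\<in>{k. 2 * k \<le> n} - {0}. P k * E (n - 2 * k))"
    by (rule sum.cong) (auto simp: less)
  then show ?case
    using assms(1)[of n] assms(2) by (simp add: sum.remove[OF fin, of 0])
qed

text \<open>With no condition on \<open>q\<close>, the two convolutions count the partitions of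
  \<open>n\<close> with alternating sum \<open>b\<close> and those with \<open>b\<close> odd parts.
  These totals agree, so the factor \<open>card (partitions k)\<close> cancels.\<close>

lemma card_distinct_s_stat_eq_card_all_odd:
  "card {d \<in> partitions n. (\<forall>x. count d x \<le> 1) \<and> s_stat d = int b} =
   card {d \<in> partitions n. (\<forall>x\<in>#d. odd x) \<and> size d = b}"
proof (rule convolution_cancel[where P = "\<lambda>k. card (partitions k)"
      and D = "\<lambda>n. card {d \<in> partitions n. (\<forall>x. count d x \<le> 1) \<and> s_stat d = int b}"
      and E = "\<lambda>n. card {d \<in> partitions n. (\<forall>x\<in>#d. odd x) \<and> size d = b}"])
  fix n
  show "(\<Sum>k | 2 * k \<le> n. card (partitions k) *
      card {d \<in> partitions (n - 2 * k). (\<forall>x. count d x \<le> 1) \<and> s_stat d = int b}) =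
    (\<Sum>k | 2 * k \<le> n. card (partitions k) *
      card {d \<in> partitions (n - 2 * k). (\<forall>x\<in>#d. odd x) \<and> size d = b})"
    using card_s_stat_eq_card_odd[of n b] card_r_stat_s_stat[of n "\<lambda>_. True" "int b"]
      card_even_odd[of n "\<lambda>_. True" b] by simp
qed (simp add: partitions_0)

theorem theorem2p3:
  fixes n a b :: nat
  shows "card {p \<in> partitions n. r_stat p = a \<and> s_stat p = int b} =
         card {p \<in> partitions n. size (filter_mset even p) = a \<and> size (filter_mset odd p) = b}"
  \<comment> \<open>The two convolutions now agree factor by factor: largest part \<open>a\<close>
    against \<open>a\<close> parts for \<open>q\<close>, and alternating sum \<open>b\<close>
    against \<open>b\<close> odd parts for \<open>d\<close>.\<close>
  by (simp only: card_r_stat_s_stat[of n "\<lambda>r. r = a"] card_even_odd[of n "\<lambda>m. m = a"]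
    card_largest_eq_card_size card_distinct_s_stat_eq_card_all_odd)

end
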